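(* Let $G$ be a finite simple graph and $r\ge 2$ an integer. The following are equivalent: (1) Either $|E(\mathrm{Con}_r(G))|\le 1$, or there exist a positive integer $k$ and an ordering of vertices $x_1,x_2,\ldots,x_k$ of $G$ such that (a) for each $i\in \{0,1,\ldots,k-1\}$, $E(\mathrm{Con}_r(G_i\setminus N_{G_i}[x_{i+1}])) = \emptyset$, where $G_0=G$ and $G_i=G\setminus\{x_1,\ldots,x_i\}$ for $i\ge 1$; and (b) $k$ is the least positive integer such that $|E(\mathrm{Con}_r(G\setminus\{x_1,\ldots,x_k\}))|\le 1$. (2) The simplicial complex $\Sigma_r(G)$ is vertex decomposable.
   Context: $\mathrm{Con}_r(H)$ is the clutter on $V(H)$ whose circuits are the $r$-subsets $W\subseteq V(H)$ with $H[W]$ connected. $\Sigma_r(G)$ is the simplicial complex generated by the sets $V(G)\setminus W$ for $W\in E(\mathrm{Con}_r(G))$ (it is the Alexander dual of the $r$-independence complex of $G$; it is the void complex if there are no such $W$). $G\setminus S$ denotes the induced subgraph on $V(G)\setminus S$; $N_H[x]$ is the closed neighborhood. A simplicial complex $\Delta$ is vertex decomposable if it is a simplex, the empty complex $\{\emptyset\}$, the void complex, or has a vertex $x$ with $\mathrm{lk}_\Delta(x)$ and $\mathrm{del}_\Delta(x)$ vertex decomposable and every facet of $\mathrm{del}_\Delta(x)$ a facet of $\Delta$. *)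

theory Defs
  imports Graph_Theory.Digraph_Component
begin

text \<open>A finite simple graph is an instance of the locale \<^locale>\<open>graph\<close>: a finite, loop-free
  symmetric digraph without parallel arcs. The graph with no vertices is not connected in the sense
  of \<^const>\<open>connected\<close>, and \<^term>\<open>G \<restriction> S\<close> has vertex set \<^term>\<open>S\<close> even
  if \<^term>\<open>S\<close> is not contained in \<^term>\<open>verts G\<close>.\<close>

definition remove_verts :: "('a,'b) pre_digraph \<Rightarrow> 'a set \<Rightarrow> ('a,'b) pre_digraph" where
  "remove_verts G S = G \<restriction> (verts G - S)"

definition closed_nbhd :: "('a,'b) pre_digraph \<Rightarrow> 'a \<Rightarrow> 'a set" where
  "closed_nbhd H x = insert x {y \<in> verts H. x \<rightarrow>\<^bsub>H\<^esub> y}"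

text \<open>The set \<open>E(Con\<^sub>r(H))\<close> of circuits; the vertex set of the clutter \<open>Con\<^sub>r(H)\<close> is
  \<^term>\<open>verts H\<close>.\<close>

definition con_circuits :: "nat \<Rightarrow> ('a,'b) pre_digraph \<Rightarrow> 'a set set" where
  "con_circuits r H = {W. W \<subseteq> verts H \<and> card W = r \<and> connected (H \<restriction> W)}"

text \<open>A finite simplicial complex is its set of faces, so the void complex is \<open>{}\<close>, the empty
  complex is \<open>{{}}\<close>, and a vertex of the complex is an \<open>x\<close> for which \<open>{x}\<close> is a face.\<close>

definition simplicial_complex :: "'a set set \<Rightarrow> bool" where
  "simplicial_complex \<Delta> \<longleftrightarrow>
     finite \<Delta> \<and> (\<forall>F\<in>\<Delta>. finite F) \<and> (\<forall>F\<in>\<Delta>. \<forall>F'. F' \<subseteq> F \<longrightarrow> F' \<in> \<Delta>)"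

definition generated_complex :: "'a set set \<Rightarrow> 'a set set" where
  "generated_complex \<A> = {F. \<exists>A\<in>\<A>. F \<subseteq> A}"

definition facets :: "'a set set \<Rightarrow> 'a set set" where
  "facets \<Delta> = {F \<in> \<Delta>. \<forall>F'\<in>\<Delta>. F \<subseteq> F' \<longrightarrow> F' = F}"

definition link :: "'a set set \<Rightarrow> 'a \<Rightarrow> 'a set set" where
  "link \<Delta> x = {F \<in> \<Delta>. x \<notin> F \<and> insert x F \<in> \<Delta>}"

definition deletion :: "'a set set \<Rightarrow> 'a \<Rightarrow> 'a set set" where
  "deletion \<Delta> x = {F \<in> \<Delta>. x \<notin> F}"

inductive vertex_decomposable :: "'a set set \<Rightarrow> bool" where
  void: "vertex_decomposable {}"
| empty: "vertex_decomposable {{}}"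
| simplex: "finite F \<Longrightarrow> vertex_decomposable (Pow F)"
| shedding: "\<lbrakk>simplicial_complex \<Delta>; {x} \<in> \<Delta>;
     vertex_decomposable (link \<Delta> x); vertex_decomposable (deletion \<Delta> x);
     facets (deletion \<Delta> x) \<subseteq> facets \<Delta>\<rbrakk> \<Longrightarrow> vertex_decomposable \<Delta>"

definition Sigma_complex :: "nat \<Rightarrow> ('a,'b) pre_digraph \<Rightarrow> 'a set set" where
  "Sigma_complex r G = generated_complex {verts G - W | W. W \<in> con_circuits r G}"

end

theory Submission
  imports Defs
begin

text \<open>
  All facets of \<open>\<Sigma>\<^sub>r(G)\<close> have the same size, so a vertex \<open>x\<close> is shedding iff every connected
  \<open>r\<close>-set avoiding \<open>x\<close> can trade one of its vertices for \<open>x\<close> and stay connected; for \<open>r \<ge> 2\<close> this says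
  that it meets the neighbourhood of \<open>x\<close>, i.e. that \<open>Con\<^sub>r(G \ N[x])\<close> has no circuit. The link of \<open>x\<close>
  is \<open>\<Sigma>\<^sub>r(G \ x)\<close>. The deletion of a shedding vertex is generated by the complements of the connected
  \<open>r\<close>-sets containing \<open>x\<close>, and this is always vertex decomposable: more generally, for a connected set
  \<open>A\<close>, any neighbour of \<open>A\<close> is a shedding vertex of the complex generated by the complements of the
  connected \<open>r\<close>-sets containing \<open>A\<close>, which allows an induction that enlarges \<open>A\<close> or shrinks the graph.
\<close>

section \<open>Complexes generated by complements\<close>

text \<open>The ground set \<open>V\<close> is a separate argument because passing to a link removes
  a vertex from it, whereas passing to a deletion keeps it.\<close>

definition dual_complex :: "'a set \<Rightarrow> 'a set set \<Rightarrow> 'a set set" where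
  "dual_complex V \<W> = generated_complex ((\<lambda>W. V - W) ` \<W>)"

text \<open>Combinatorial form of the facet condition at a vertex \<open>y \<in> V\<close>, for
  circuits of equal size inside a finite \<open>V\<close>: such a \<open>W'\<close> arises from
  \<open>W\<close> by trading one vertex for \<open>y\<close>.\<close>

definition sheds :: "'a set set \<Rightarrow> 'a \<Rightarrow> bool" where
  "sheds \<W> y \<longleftrightarrow> (\<forall>W\<in>\<W>. y \<notin> W \<longrightarrow> (\<exists>W'\<in>\<W>. y \<in> W' \<and> W' \<subseteq> insert y W))"

lemma mem_dual_complex: "F \<in> dual_complex V \<W> \<longleftrightarrow> (\<exists>W\<in>\<W>. F \<subseteq> V - W)"
  by (auto simp: dual_complex_def generated_complex_def)

lemma dual_complex_empty [simp]: "dual_complex V {} = {}"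
  by (auto simp: mem_dual_complex)

lemma dual_complex_singleton [simp]: "dual_complex V {W} = Pow (V - W)"
  by (auto simp: mem_dual_complex)

lemma simplicial_complex_dual_complex:
  assumes "finite V" shows "simplicial_complex (dual_complex V \<W>)"
proof -
  have sub: "dual_complex V \<W> \<subseteq> Pow V" by (auto simp: mem_dual_complex)
  show ?thesis
    unfolding simplicial_complex_def
  proof (intro conjI ballI allI impI)
    show "finite (dual_complex V \<W>)" using sub assms by (auto intro: finite_subset)
    show "finite F" if "F \<in> dual_complex V \<W>" for F
      using sub that assms by (auto intro: finite_subset)
  qed (auto simp: mem_dual_complex; blast)
qed

lemma link_dual_complex:
  assumes "y \<in> V"
  shows "link (dual_complex V \<W>) y = dual_complex (V - {y}) {W \<in> \<W>. y \<notin> W}"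
proof (rule set_eqI)
  fix F
  have "F \<subseteq> V - {y} - W \<longleftrightarrow> insert y F \<subseteq> insert y (V - W) \<and> y \<notin> F" for W by auto
  then show "F \<in> link (dual_complex V \<W>) y \<longleftrightarrow> F \<in> dual_complex (V - {y}) {W \<in> \<W>. y \<notin> W}"
    using assms unfolding link_def mem_Collect_eq mem_dual_complex by blast
qed

text \<open>A face that avoids both \<open>y\<close> and \<open>W\<close> also avoids every
  \<open>W' \<subseteq> insert y W\<close>, so the exchange replaces each generator by one whose
  circuit contains \<open>y\<close>.\<close>

lemma deletion_dual_complex:
  assumes "sheds \<W> y"
  shows "deletion (dual_complex V \<W>) y = dual_complex V {W \<in> \<W>. y \<in> W}"
proof (rule set_eqI)
  fix F
  show "F \<in> deletion (dual_complex V \<W>) y \<longleftrightarrow> F \<in> dual_complex V {W \<in> \<W>. y \<in> W}"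
  proof
    assume "F \<in> deletion (dual_complex V \<W>) y"
    then obtain W where W: "W \<in> \<W>" "F \<subseteq> V - W" "y \<notin> F"
      by (auto simp: deletion_def mem_dual_complex)
    obtain W' where "W' \<in> \<W>" "y \<in> W'" "W' \<subseteq> insert y W"
    proof (cases "y \<in> W")
      case True
      with W(1) show ?thesis by (intro that) auto
    next
      case False
      with W(1) assms show ?thesis using that by (auto simp: sheds_def)
    qed
    with W show "F \<in> dual_complex V {W \<in> \<W>. y \<in> W}"
      by (auto simp: mem_dual_complex intro!: bexI[of _ W'])
  qed (auto simp: deletion_def mem_dual_complex)
qed

text \<open>Circuits of equal finite size are pairwise incomparable, hence so are their complements,
  and every generator is maximal.\<close>

lemma facets_dual_complex:
  assumes "finite V" and sub: "\<W> \<subseteq> Pow V" and card: "\<And>W. W \<in> \<W> \<Longrightarrow> card W = n"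
  shows "facets (dual_complex V \<W>) = (\<lambda>W. V - W) ` \<W>"
proof
  show "facets (dual_complex V \<W>) \<subseteq> (\<lambda>W. V - W) ` \<W>"
  proof
    fix F assume "F \<in> facets (dual_complex V \<W>)"
    then have F: "F \<in> dual_complex V \<W>" "\<And>F'. F' \<in> dual_complex V \<W> \<Longrightarrow> F \<subseteq> F' \<Longrightarrow> F' = F"
      by (auto simp: facets_def)
    from F(1) obtain W where W: "W \<in> \<W>" "F \<subseteq> V - W" by (auto simp: mem_dual_complex)
    then have "V - W \<in> dual_complex V \<W>" by (auto simp: mem_dual_complex)
    with F(2) W show "F \<in> (\<lambda>W. V - W) ` \<W>" by blast
  qed
  show "(\<lambda>W. V - W) ` \<W> \<subseteq> facets (dual_complex V \<W>)"
  proof safe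
    fix W assume W: "W \<in> \<W>"
    have "F = V - W" if "W' \<in> \<W>" "F \<subseteq> V - W'" "V - W \<subseteq> F" for F W'
    proof -
      have "W' \<subseteq> W" using that sub by auto
      moreover have "finite W" using W sub assms(1) by (auto intro: finite_subset)
      moreover have "card W' = card W" using that W card by auto
      ultimately have "W' = W" by (metis card_subset_eq)
      with that show ?thesis by auto
    qed
    then have "F = V - W" if "F \<in> dual_complex V \<W>" "V - W \<subseteq> F" for F
      using that unfolding mem_dual_complex by blast
    moreover have "V - W \<in> dual_complex V \<W>" using W by (auto simp: mem_dual_complex)
    ultimately show "V - W \<in> facets (dual_complex V \<W>)" by (simp add: facets_def)
  qed
qed

lemma vertex_decomposable_dual_complexI:
  assumes fin: "finite V" and sub: "\<W> \<subseteq> Pow V" and card: "\<And>W. W \<in> \<W> \<Longrightarrow> card W = n"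
    and y: "y \<in> V" and sheds: "sheds \<W> y"
    and link: "vertex_decomposable (dual_complex (V - {y}) {W \<in> \<W>. y \<notin> W})"
    and del: "vertex_decomposable (dual_complex V {W \<in> \<W>. y \<in> W})"
  shows "vertex_decomposable (dual_complex V \<W>)"
\<comment> \<open>The rule \<open>shedding\<close> requires \<open>{y}\<close> to be a face, which
  fails if every circuit contains \<open>y\<close>; then \<open>del\<close> already speaks of the
  whole complex.\<close>
proof (cases "\<forall>W\<in>\<W>. y \<in> W")
  case True
  then have "{W \<in> \<W>. y \<in> W} = \<W>" by auto
  with del show ?thesis by simp
next
  case False
  show ?thesis
  proof (rule vertex_decomposable.shedding)
    show "simplicial_complex (dual_complex V \<W>)"
      using fin by (rule simplicial_complex_dual_complex)
    show "{y} \<in> dual_complex V \<W>" using False y by (auto simp: mem_dual_complex)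
    show "vertex_decomposable (link (dual_complex V \<W>) y)"
      using link y by (simp add: link_dual_complex)
    show "vertex_decomposable (deletion (dual_complex V \<W>) y)"
      using del sheds by (simp add: deletion_dual_complex)
    have "facets (deletion (dual_complex V \<W>) y) = (\<lambda>W. V - W) ` {W \<in> \<W>. y \<in> W}"
      unfolding deletion_dual_complex[OF sheds]
      by (rule facets_dual_complex[OF fin, of _ n]) (use sub card in auto)
    moreover have "facets (dual_complex V \<W>) = (\<lambda>W. V - W) ` \<W>"
      using fin sub card by (rule facets_dual_complex)
    ultimately show "facets (deletion (dual_complex V \<W>) y) \<subseteq> facets (dual_complex V \<W>)"
      by auto
  qed
qed

text \<open>If some \<open>W\<close> violated the exchange condition, then \<open>V - W - {y}\<close> would be a facet of the deletion
  that is properly contained in the face \<open>V - W\<close>.\<close>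

lemma sheds_if_facets_deletion:
  assumes fin: "finite V" and sub: "\<W> \<subseteq> Pow V" and card: "\<And>W. W \<in> \<W> \<Longrightarrow> card W = n"
    and y: "y \<in> V"
    and facets: "facets (deletion (dual_complex V \<W>) y) \<subseteq> facets (dual_complex V \<W>)"
  shows "sheds \<W> y"
  unfolding sheds_def
proof (intro ballI impI, rule ccontr)
  fix W assume W: "W \<in> \<W>" "y \<notin> W" and no: "\<not> (\<exists>W'\<in>\<W>. y \<in> W' \<and> W' \<subseteq> insert y W)"
  have "F = V - W - {y}" if "W' \<in> \<W>" "F \<subseteq> V - W'" "y \<notin> F" "V - W - {y} \<subseteq> F" for F W'
  proof -
    have "W' \<subseteq> insert y W" using that sub by auto
    with no that have "W' \<subseteq> W" by auto
    moreover have "finite W" using W sub fin by (auto intro: finite_subset)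
    moreover have "card W' = card W" using that W card by auto
    ultimately have "W' = W" by (metis card_subset_eq)
    with that show ?thesis by auto
  qed
  with W have "V - W - {y} \<in> facets (deletion (dual_complex V \<W>) y)"
    unfolding facets_def deletion_def by (auto simp: mem_dual_complex)
  with facets have "V - W - {y} \<in> facets (dual_complex V \<W>)" by auto
  moreover have "V - W \<in> dual_complex V \<W>" using W by (auto simp: mem_dual_complex)
  ultimately have "V - W = V - W - {y}" unfolding facets_def by blast
  with W y show False by auto
qed

section \<open>Connected vertex sets\<close>

text \<open>Reachability is traded for cuts: a walk leaving \<open>A\<close> must cross its
  boundary, and conversely the set reachable from a vertex has no outgoing edge. Later arguments
  then only have to exhibit single edges.\<close>

lemma (in sym_digraph) connected_induce_iff_cut:
  "connected (G \<restriction> W) \<longleftrightarrow>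
    W \<noteq> {} \<and> (\<forall>A. A \<subseteq> W \<longrightarrow> A \<noteq> {} \<longrightarrow> A \<noteq> W \<longrightarrow> (\<exists>a\<in>A. \<exists>b\<in>W - A. a \<rightarrow>\<^bsub>G\<^esub> b))"
proof -
  define R where "R = {(a, b). a \<in> W \<and> b \<in> W \<and> a \<rightarrow>\<^bsub>G\<^esub> b}"
  have ends: "arcs_ends (G \<restriction> W) = R"
    by (auto simp: R_def arcs_ends_conv image_iff)
  \<comment> \<open>\<open>connected\<close> refers to the symmetric closure of the arcs, which is
    \<open>R\<close> itself because \<open>G\<close> is symmetric.\<close>
  have "(b, a) \<in> R" if "(a, b) \<in> R" for a b
    using that graph_symmetric by (auto simp: R_def)
  then have sym: "symcl R = R"
    by (auto simp: symcl_def)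
  have "connected (G \<restriction> W) \<longleftrightarrow> W \<noteq> {} \<and> (\<forall>u\<in>W. \<forall>v\<in>W. (u, v) \<in> rtrancl_on W R)"
    unfolding connected_conv ends sym by simp
  moreover have "(\<forall>u\<in>W. \<forall>v\<in>W. (u, v) \<in> rtrancl_on W R) \<longleftrightarrow>
    (\<forall>A. A \<subseteq> W \<longrightarrow> A \<noteq> {} \<longrightarrow> A \<noteq> W \<longrightarrow> (\<exists>a\<in>A. \<exists>b\<in>W - A. a \<rightarrow>\<^bsub>G\<^esub> b))"
    (is "?reach \<longleftrightarrow> ?cut")
  proof
    assume reach: ?reach
    show ?cut
    proof (intro allI impI, rule ccontr)
      fix A assume A: "A \<subseteq> W" "A \<noteq> {}" "A \<noteq> W"
        and no: "\<not> (\<exists>a\<in>A. \<exists>b\<in>W - A. a \<rightarrow>\<^bsub>G\<^esub> b)"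
      from A obtain u v where uv: "u \<in> A" "v \<in> W" "v \<notin> A" by auto
      then have "(u, v) \<in> rtrancl_on W R" using reach A by auto
      then have "v \<in> A"
      proof (induct rule: rtrancl_on_induct)
        case (step a b)
        with no show ?case by (auto simp: R_def)
      qed (use uv in simp)
      with uv show False by simp
    qed
  next
    assume cut: ?cut
    show ?reach
    proof (intro ballI)
      fix u v assume uv: "u \<in> W" "v \<in> W"
      define A where "A = {w \<in> W. (u, w) \<in> rtrancl_on W R}"
      have "A = W"
      proof (rule ccontr)
        assume "A \<noteq> W"
        moreover have "A \<subseteq> W" "u \<in> A" using uv by (auto simp: A_def)
        ultimately obtain a b where ab: "a \<in> A" "b \<in> W - A" "a \<rightarrow>\<^bsub>G\<^esub> b" using cut by blast
        then have "(u, a) \<in> rtrancl_on W R" "(a, b) \<in> R" by (auto simp: A_def R_def)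
        with ab have "(u, b) \<in> rtrancl_on W R" by (auto intro: rtrancl_on_into_rtrancl_on)
        with ab show False by (auto simp: A_def)
      qed
      with uv show "(u, v) \<in> rtrancl_on W R" by (auto simp: A_def)
    qed
  qed
  ultimately show ?thesis by simp
qed

context sym_digraph
begin

lemma connected_induce_cutE:
  assumes "connected (G \<restriction> W)" "A \<subseteq> W" "A \<noteq> {}" "A \<noteq> W"
  obtains a b where "a \<in> A" "b \<in> W - A" "a \<rightarrow>\<^bsub>G\<^esub> b"
  using assms unfolding connected_induce_iff_cut by blast

lemma connected_induce_singleton: "connected (G \<restriction> {x})"
  unfolding connected_induce_iff_cut by auto

lemma connected_induce_insert:
  assumes conn: "connected (G \<restriction> A)" and "a \<in> A" "a \<rightarrow>\<^bsub>G\<^esub> y"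
  shows "connected (G \<restriction> insert y A)"
  unfolding connected_induce_iff_cut
proof (intro conjI allI impI)
  fix B assume B: "B \<subseteq> insert y A" "B \<noteq> {}" "B \<noteq> insert y A"
  \<comment> \<open>In the first two cases the edge between \<open>a\<close> and \<open>y\<close>
    crosses the cut; in the third the cut already separates \<open>A\<close>.\<close>
  consider "B \<inter> A = {}" | "A \<subseteq> B" | "B \<inter> A \<noteq> {}" "B \<inter> A \<noteq> A" by auto
  then show "\<exists>a\<in>B. \<exists>b\<in>insert y A - B. a \<rightarrow>\<^bsub>G\<^esub> b"
  proof cases
    case 1
    with B have "y \<in> B" by auto
    with 1 assms graph_symmetric[of a y] show ?thesis by auto
  next
    case 2
    with B have "y \<notin> B" by auto
    with 2 assms show ?thesis by auto
  next
    case 3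
    with conn obtain c b where "c \<in> B \<inter> A" "b \<in> A - B \<inter> A" "c \<rightarrow>\<^bsub>G\<^esub> b"
      by (metis connected_induce_cutE inf_le2)
    then show ?thesis by auto
  qed
qed auto

text \<open>Growing \<open>A\<close> inside \<open>W\<close> one vertex at a time: as long as the
  current set is proper, some edge of \<open>W\<close> leaves it, and adding the endpoint preserves
  connectedness.\<close>

lemma connected_induce_between:
  assumes A: "connected (G \<restriction> A)" and W: "connected (G \<restriction> W)" "finite W" and "A \<subseteq> W"
    and n: "card A \<le> n" "n \<le> card W"
  obtains B where "connected (G \<restriction> B)" "A \<subseteq> B" "B \<subseteq> W" "card B = n"
proof -
  have "\<exists>B. connected (G \<restriction> B) \<and> A \<subseteq> B \<and> B \<subseteq> W \<and> card B = n"
    using n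
  proof (induction n rule: dec_induct)
    case base
    show ?case using A \<open>A \<subseteq> W\<close> by auto
  next
    case (step m)
    then obtain B where B: "connected (G \<restriction> B)" "A \<subseteq> B" "B \<subseteq> W" "card B = m" by auto
    then have "B \<noteq> W" "B \<noteq> {}" "finite B"
      using step.prems W(2) by (auto simp: connected_induce_iff_cut intro: finite_subset)
    then obtain a b where "a \<in> B" "b \<in> W - B" "a \<rightarrow>\<^bsub>G\<^esub> b"
      using W(1) B(3) by (metis connected_induce_cutE)
    with B \<open>finite B\<close> show ?case
      by (intro exI[of _ "insert b B"]) (auto intro: connected_induce_insert)
  qed
  with that show ?thesis by blast
qed

section \<open>Circuits through a fixed connected set\<close>

definition circuits_containing :: "nat \<Rightarrow> 'a set \<Rightarrow> 'a set \<Rightarrow> 'a set set" where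
  "circuits_containing r A S =
    {W. A \<subseteq> W \<and> W \<subseteq> S \<and> card W = r \<and> connected (G \<restriction> W)}"

text \<open>Both \<open>insert y A\<close> and \<open>insert y W\<close> are connected, and
  \<open>card A < r\<close> leaves room for \<open>y\<close>, so a connected set of size
  \<open>r\<close> lies between them.\<close>

lemma sheds_circuits_containing:
  assumes fin: "finite S" and A: "connected (G \<restriction> A)" and less: "card A < r"
    and y: "y \<in> S" "a \<in> A" "a \<rightarrow>\<^bsub>G\<^esub> y"
  shows "sheds (circuits_containing r A S) y"
  unfolding sheds_def
proof (intro ballI impI)
  fix W assume "W \<in> circuits_containing r A S" and yW: "y \<notin> W"
  then have W: "A \<subseteq> W" "W \<subseteq> S" "card W = r" "connected (G \<restriction> W)"
    by (auto simp: circuits_containing_def)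
  then have finW: "finite W" using fin by (auto intro: finite_subset)
  with W have finA: "finite A" by (auto intro: finite_subset)
  have conn: "connected (G \<restriction> insert y A)" "connected (G \<restriction> insert y W)"
    using A y W by (auto intro: connected_induce_insert)
  have "finite (insert y W)" "insert y A \<subseteq> insert y W"
    "card (insert y A) \<le> r" "r \<le> card (insert y W)"
    using less finA finW W yW by (auto simp: card_insert_if)
  then obtain B where "connected (G \<restriction> B)" "insert y A \<subseteq> B" "B \<subseteq> insert y W" "card B = r"
    by (rule connected_induce_between[OF conn])
  then show "\<exists>W'\<in>circuits_containing r A S. y \<in> W' \<and> W' \<subseteq> insert y W"
    using W y by (intro bexI[of _ B]) (auto simp: circuits_containing_def)
qed

text \<open>With \<open>A = {x}\<close> this settles the deletion of any shedding vertex
  \<open>x\<close>. In the measure, the link lowers the first summand without raising the second,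
  and the deletion moves \<open>y\<close> into \<open>A\<close> and lowers the second.\<close>

lemma vertex_decomposable_circuits_containing:
  assumes "finite S" "connected (G \<restriction> A)"
  shows "vertex_decomposable (dual_complex S (circuits_containing r A S))"
  using assms
proof (induction "card S + card (S - A)" arbitrary: A S rule: less_induct)
  case less
  note fin = less.prems(1) and A = less.prems(2)
  show ?case
  proof (cases "circuits_containing r A S \<subseteq> {A}")
    case True
    then have "circuits_containing r A S = {} \<or> circuits_containing r A S = {A}" by auto
    with fin show ?thesis
      by (auto simp: vertex_decomposable.void vertex_decomposable.simplex)
  next
    case False
    then obtain W where W: "A \<subseteq> W" "A \<noteq> W" "W \<subseteq> S" "card W = r" "connected (G \<restriction> W)"
      by (auto simp: circuits_containing_def)
    \<comment> \<open>A circuit properly larger than \<open>A\<close> supplies a neighbour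
      \<open>y\<close> of \<open>A\<close> lying in \<open>S\<close>, the shedding vertex.\<close>
    with A obtain a y where y: "a \<in> A" "y \<in> W - A" "a \<rightarrow>\<^bsub>G\<^esub> y"
      by (metis connected_induce_cutE connected_induce_iff_cut)
    have "finite W" using W fin by (auto intro: finite_subset)
    with W have "card A < r" by (auto intro: psubset_card_mono)
    show ?thesis
    proof (rule vertex_decomposable_dual_complexI[where n = r])
      show "y \<in> S" using y W by auto
      then show "sheds (circuits_containing r A S) y"
        using sheds_circuits_containing fin A \<open>card A < r\<close> y by blast
      have "card (S - {y}) < card S"
        using fin \<open>y \<in> S\<close> by (rule card_Diff1_less)
      moreover have "card (S - {y} - A) \<le> card (S - A)"
        using fin by (auto intro: card_mono)
      ultimately have "vertex_decomposable (dual_complex (S - {y}) (circuits_containing r A (S - {y})))"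
        using fin A by (intro less.hyps) (simp_all del: card_Diff_singleton)
      moreover have "{W \<in> circuits_containing r A S. y \<notin> W} = circuits_containing r A (S - {y})"
        by (auto simp: circuits_containing_def)
      ultimately show "vertex_decomposable
          (dual_complex (S - {y}) {W \<in> circuits_containing r A S. y \<notin> W})" by simp
      have "card (S - insert y A) < card (S - A)"
        using fin \<open>y \<in> S\<close> y by (intro psubset_card_mono) auto
      then have "vertex_decomposable (dual_complex S (circuits_containing r (insert y A) S))"
        using fin A y by (intro less.hyps) (auto intro: connected_induce_insert)
      moreover have "{W \<in> circuits_containing r A S. y \<in> W} = circuits_containing r (insert y A) S"
        by (auto simp: circuits_containing_def)
      ultimately show "vertex_decomposable
          (dual_complex S {W \<in> circuits_containing r A S. y \<in> W})" by simp
    qed (use fin in \<open>auto simp: circuits_containing_def\<close>)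
  qed
qed

section \<open>Elimination orders\<close>

abbreviation circuits_in :: "nat \<Rightarrow> 'a set \<Rightarrow> 'a set set" where
  "circuits_in r \<equiv> circuits_containing r {}"

lemma finite_circuits_in: "finite S \<Longrightarrow> finite (circuits_in r S)"
  by (rule finite_subset[of _ "Pow S"]) (auto simp: circuits_containing_def)

lemma circuits_in_remove: "{W \<in> circuits_in r S. y \<notin> W} = circuits_in r (S - {y})"
  by (auto simp: circuits_containing_def)

text \<open>This turns the shedding condition into condition (a) of the elimination order.\<close>

lemma sheds_circuits_in_iff:
  assumes fin: "finite S" and "y \<in> S" and r: "r \<ge> 2"
  shows "sheds (circuits_in r S) y \<longleftrightarrow> circuits_in r (S - insert y {z. y \<rightarrow>\<^bsub>G\<^esub> z}) = {}"
proof
  assume sheds: "sheds (circuits_in r S) y"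
  show "circuits_in r (S - insert y {z. y \<rightarrow>\<^bsub>G\<^esub> z}) = {}"
  proof (rule ccontr)
    assume "circuits_in r (S - insert y {z. y \<rightarrow>\<^bsub>G\<^esub> z}) \<noteq> {}"
    then obtain W where W: "W \<in> circuits_in r S" "y \<notin> W" "W \<inter> {z. y \<rightarrow>\<^bsub>G\<^esub> z} = {}"
      by (auto simp: circuits_containing_def)
    with sheds obtain W' where W': "W' \<in> circuits_in r S" "y \<in> W'" "W' \<subseteq> insert y W"
      by (auto simp: sheds_def)
    then have "connected (G \<restriction> W')" "card W' = r" by (auto simp: circuits_containing_def)
    \<comment> \<open>Here \<open>r \<ge> 2\<close> enters: \<open>W'\<close> has a vertex besides
      \<open>y\<close>, so an edge leads from \<open>y\<close> to a vertex of
      \<open>W' - {y}\<close>, hence of \<open>W\<close>.\<close>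
    moreover from this r have "{y} \<noteq> W'" by auto
    ultimately obtain b where "b \<in> W' - {y}" "y \<rightarrow>\<^bsub>G\<^esub> b"
      using connected_induce_cutE[of W' "{y}"] W'(2) by auto
    with W W' show False by auto
  qed
next
  assume none: "circuits_in r (S - insert y {z. y \<rightarrow>\<^bsub>G\<^esub> z}) = {}"
  show "sheds (circuits_in r S) y"
    unfolding sheds_def
  proof (intro ballI impI)
    fix W assume W: "W \<in> circuits_in r S" "y \<notin> W"
    with none obtain w where w: "w \<in> W" "y \<rightarrow>\<^bsub>G\<^esub> w"
      by (auto simp: circuits_containing_def)
    have "finite W" using W fin by (auto simp: circuits_containing_def intro: finite_subset)
    moreover have "connected (G \<restriction> insert y W)"
      using W w graph_symmetric
      by (intro connected_induce_insert[of W w]) (auto simp: circuits_containing_def)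
    moreover have "card W = r" using W by (auto simp: circuits_containing_def)
    \<comment> \<open>Growing from \<open>{y}\<close> up to size \<open>r\<close> inside
      \<open>insert y W\<close>, which has \<open>r + 1\<close> elements, performs the
      exchange.\<close>
    ultimately obtain B where "connected (G \<restriction> B)" "{y} \<subseteq> B" "B \<subseteq> insert y W" "card B = r"
      using connected_induce_between[of "{y}" "insert y W" r] connected_induce_singleton r W(2)
      by auto
    then show "\<exists>W'\<in>circuits_in r S. y \<in> W' \<and> W' \<subseteq> insert y W"
      using W \<open>y \<in> S\<close> by (intro bexI[of _ B]) (auto simp: circuits_containing_def)
  qed
qed

text \<open>Length \<open>0\<close> is allowed and minimality of \<open>k\<close> is not imposed, so
  that the notion can be unfolded recursively from its first vertex.\<close>

definition elimination_order :: "nat \<Rightarrow> 'a set \<Rightarrow> nat \<Rightarrow> (nat \<Rightarrow> 'a) \<Rightarrow> bool" where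
  "elimination_order r S k f \<longleftrightarrow> f ` {..<k} \<subseteq> S \<and> inj_on f {..<k} \<and>
    (\<forall>i<k. circuits_in r (S - f ` {..<i} - insert (f i) {z. f i \<rightarrow>\<^bsub>G\<^esub> z}) = {}) \<and>
    card (circuits_in r (S - f ` {..<k})) \<le> 1"

text \<open>Splitting off the first vertex matches one use of the rule \<open>shedding\<close>: the
  tail is an order on the ground set of the link.\<close>

lemma elimination_order_Suc:
  "elimination_order r S (Suc k) f \<longleftrightarrow>
    f 0 \<in> S \<and> circuits_in r (S - insert (f 0) {z. f 0 \<rightarrow>\<^bsub>G\<^esub> z}) = {} \<and>
    elimination_order r (S - {f 0}) k (\<lambda>i. f (Suc i))"
proof -
  have image: "f ` {..<Suc i} = insert (f 0) ((\<lambda>i. f (Suc i)) ` {..<i})" for i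
    by (simp add: lessThan_Suc_eq_insert_0 image_image)
  have diff: "S - f ` {..<Suc i} = S - {f 0} - (\<lambda>i. f (Suc i)) ` {..<i}" for i
    unfolding image by auto
  have inj: "inj_on f {..<Suc k} \<longleftrightarrow>
      f 0 \<notin> (\<lambda>i. f (Suc i)) ` {..<k} \<and> inj_on (\<lambda>i. f (Suc i)) {..<k}"
    unfolding lessThan_Suc_eq_insert_0 by (fastforce simp: inj_on_def)
  show ?thesis
    unfolding elimination_order_def All_less_Suc2 diff inj unfolding image
    by (simp add: subset_Diff_insert; blast)
qed

text \<open>Induction on the length: the tail of the order handles the link, and the deletion
  consists of the circuits through one vertex.\<close>

lemma vertex_decomposable_if_elimination_order:
  assumes "finite S" "r \<ge> 2" "elimination_order r S k f"
  shows "vertex_decomposable (dual_complex S (circuits_in r S))"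
  using assms(1,3)
proof (induction k arbitrary: S f)
  case 0
  then have "card (circuits_in r S) \<le> 1" by (simp add: elimination_order_def)
  \<comment> \<open>Finiteness rules out an infinite family, whose \<open>card\<close> would be
    \<open>0\<close>.\<close>
  then consider "circuits_in r S = {}" | W where "circuits_in r S = {W}"
    using finite_circuits_in[OF \<open>finite S\<close>]
    by (metis One_nat_def card_0_eq card_1_singletonE le_Suc_eq le_zero_eq)
  then show ?case
    using \<open>finite S\<close> by cases (simp_all add: vertex_decomposable.void vertex_decomposable.simplex)
next
  case (Suc k)
  let ?y = "f 0"
  have y: "?y \<in> S" "circuits_in r (S - insert ?y {z. ?y \<rightarrow>\<^bsub>G\<^esub> z}) = {}"
    and rest: "elimination_order r (S - {?y}) k (\<lambda>i. f (Suc i))"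
    using Suc.prems(2) by (auto simp: elimination_order_Suc)
  show ?case
  proof (rule vertex_decomposable_dual_complexI[where n = r and y = ?y])
    show "sheds (circuits_in r S) ?y"
      using y Suc.prems(1) assms(2) by (simp add: sheds_circuits_in_iff)
    show "vertex_decomposable (dual_complex (S - {?y}) {W \<in> circuits_in r S. ?y \<notin> W})"
      unfolding circuits_in_remove using rest Suc.prems(1) by (intro Suc.IH) auto
    have "{W \<in> circuits_in r S. ?y \<in> W} = circuits_containing r {?y} S"
      by (auto simp: circuits_containing_def)
    then show "vertex_decomposable (dual_complex S {W \<in> circuits_in r S. ?y \<in> W})"
      using vertex_decomposable_circuits_containing[OF Suc.prems(1) connected_induce_singleton]
      by simp
  qed (use Suc.prems(1) y in \<open>auto simp: circuits_containing_def\<close>)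
qed

text \<open>Rule induction in which the links along a decomposition give the order; each base case
  has at most one circuit, so length \<open>0\<close> suffices there.\<close>

lemma elimination_order_if_vertex_decomposable:
  assumes "vertex_decomposable (dual_complex S (circuits_in r S))" and "finite S" "r \<ge> 2"
  shows "\<exists>k f. elimination_order r S k f"
  using assms(1,2)
proof (induction "dual_complex S (circuits_in r S)" arbitrary: S rule: vertex_decomposable.induct)
  case void
  have "S - W \<in> dual_complex S (circuits_in r S)" if "W \<in> circuits_in r S" for W
    using that by (auto simp: mem_dual_complex)
  with void.hyps have "circuits_in r S = {}" by blast
  then have "elimination_order r S 0 undefined" by (simp add: elimination_order_def)
  then show ?case by blast
next
  case empty
  have "W = S" if "W \<in> circuits_in r S" for W
  proof -
    have "S - W \<in> dual_complex S (circuits_in r S)" using that by (auto simp: mem_dual_complex)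
    then have "S - W \<in> {{}}" unfolding empty(1) .
    with that show ?thesis by (auto simp: circuits_containing_def)
  qed
  then have "circuits_in r S \<subseteq> {S}" by auto
  then have "card (circuits_in r S) \<le> card {S}" by (intro card_mono) auto
  then have "elimination_order r S 0 undefined" by (simp add: elimination_order_def)
  then show ?case by blast
next
  case (simplex F)
  \<comment> \<open>A simplex has a single facet, and distinct circuits have distinct complements as
    facets.\<close>
  have "facets (Pow F) = {F}" unfolding facets_def by auto
  moreover have "facets (Pow F) = (\<lambda>W. S - W) ` circuits_in r S"
    unfolding simplex.hyps(2) using simplex.prems by (rule facets_dual_complex[of _ _ r]) (auto simp: circuits_containing_def)
  ultimately have "(\<lambda>W. S - W) ` circuits_in r S = {F}" by simp
  then have "S - W = F" if "W \<in> circuits_in r S" for W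
    using that by (metis imageI singletonD)
  then have "circuits_in r S \<subseteq> {S - F}" by (auto simp: circuits_containing_def)
  then have "card (circuits_in r S) \<le> card {S - F}" by (intro card_mono) auto
  then have "elimination_order r S 0 undefined" by (simp add: elimination_order_def)
  then show ?case by blast
next
  case (shedding x)
  have "x \<in> S" using shedding.hyps(2) by (auto simp: mem_dual_complex)
  have "sheds (circuits_in r S) x"
    using shedding.prems(1) _ _ \<open>x \<in> S\<close> shedding.hyps(7)
    by (rule sheds_if_facets_deletion[of _ _ r]) (auto simp: circuits_containing_def)
  then have none: "circuits_in r (S - insert x {z. x \<rightarrow>\<^bsub>G\<^esub> z}) = {}"
    using shedding.prems(1) \<open>x \<in> S\<close> assms(3) by (simp add: sheds_circuits_in_iff)
  have "link (dual_complex S (circuits_in r S)) x = dual_complex (S - {x}) (circuits_in r (S - {x}))"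
    using \<open>x \<in> S\<close> by (simp add: link_dual_complex circuits_in_remove)
  then obtain k f where "elimination_order r (S - {x}) k f"
    using shedding.hyps(4) shedding.prems(1) by blast
  \<comment> \<open>\<open>case_nat x f\<close> places \<open>x\<close> in front of the order found
    for the link.\<close>
  then have "elimination_order r S (Suc k) (case_nat x f)"
    using \<open>x \<in> S\<close> none by (simp add: elimination_order_Suc)
  then show ?case by blast
qed

section \<open>Translation to induced subgraphs and closed neighbourhoods\<close>

lemma induce_induce: "T \<subseteq> S \<Longrightarrow> (G \<restriction> S) \<restriction> T = G \<restriction> T"
  by (auto simp: induce_subgraph_def)

lemma con_circuits_induce: "con_circuits r (G \<restriction> S) = circuits_in r S"
  by (auto simp: con_circuits_def circuits_containing_def induce_induce)

lemma con_circuits_verts: "con_circuits r G = circuits_in r (verts G)"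
  by (auto simp: con_circuits_def circuits_containing_def)

lemma con_circuits_remove_closed_nbhd:
  assumes "x \<in> S"
  shows "con_circuits r (remove_verts (G \<restriction> S) (closed_nbhd (G \<restriction> S) x)) =
    circuits_in r (S - insert x {z. x \<rightarrow>\<^bsub>G\<^esub> z})"
proof -
  have "S - closed_nbhd (G \<restriction> S) x = S - insert x {z. x \<rightarrow>\<^bsub>G\<^esub> z}"
    using assms by (auto simp: closed_nbhd_def arcs_ends_conv image_iff)
  then show ?thesis
    by (simp add: remove_verts_def induce_induce con_circuits_induce)
qed

end

text \<open>An elimination order is indexed from \<open>0\<close> and may be cut off at its first prefix leaving at most
  one circuit; the empty prefix corresponds to the first alternative of (1).\<close>

theorem theorem3p10:
  fixes G :: "('a,'b) pre_digraph" and r :: nat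
  assumes "graph G" and "r \<ge> 2"
  shows "(card (con_circuits r G) \<le> 1 \<or>
      (\<exists>(k::nat) (x :: nat \<Rightarrow> 'a).
         k \<ge> 1 \<and> x ` {1..k} \<subseteq> verts G \<and> inj_on x {1..k} \<and>
         (\<forall>i\<in>{0..<k}. let G\<^sub>i = remove_verts G (x ` {1..i}) in
            con_circuits r (remove_verts G\<^sub>i (closed_nbhd G\<^sub>i (x (i+1)))) = {}) \<and>
         card (con_circuits r (remove_verts G (x ` {1..k}))) \<le> 1 \<and>
         (\<forall>j\<in>{1..<k}. \<not> card (con_circuits r (remove_verts G (x ` {1..j}))) \<le> 1)))
    \<longleftrightarrow> vertex_decomposable (Sigma_complex r G)"
    (is "?small \<or> (\<exists>k x. ?order k x) \<longleftrightarrow> _")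
proof -
  interpret graph G by fact
  let ?V = "verts G"
  have Sigma: "Sigma_complex r G = dual_complex ?V (circuits_in r ?V)"
    by (simp add: Sigma_complex_def dual_complex_def con_circuits_verts Setcompr_eq_image)
  have order_iff: "?order k x \<longleftrightarrow> 1 \<le> k \<and> elimination_order r ?V k (\<lambda>i. x (Suc i)) \<and>
      (\<forall>j\<in>{1..<k}. \<not> card (circuits_in r (?V - x ` Suc ` {..<j})) \<le> 1)" for k x
  proof -
    \<comment> \<open>The vertices of the statement are numbered from \<open>1\<close>, those of an
      elimination order from \<open>0\<close>.\<close>
    have shift: "{1..i} = Suc ` {..<i}" for i
      by (simp add: image_Suc_lessThan)
    have inj: "inj_on x (Suc ` {..<k}) \<longleftrightarrow> inj_on (\<lambda>i. x (Suc i)) {..<k}"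
      by (auto simp: inj_on_def)
    \<comment> \<open>Injectivity guarantees that \<open>x (Suc i)\<close> is not among the vertices
      removed before, so it still lies in the current vertex set.\<close>
    have step: "con_circuits r (remove_verts (G \<restriction> (?V - x ` Suc ` {..<i}))
          (closed_nbhd (G \<restriction> (?V - x ` Suc ` {..<i})) (x (Suc i)))) =
        circuits_in r (?V - x ` Suc ` {..<i} - insert (x (Suc i)) {z. x (Suc i) \<rightarrow>\<^bsub>G\<^esub> z})"
      if "x ` Suc ` {..<k} \<subseteq> ?V" "inj_on (\<lambda>i. x (Suc i)) {..<k}" "i < k" for i
      using that by (intro con_circuits_remove_closed_nbhd) (fastforce dest: inj_onD)
    have rv: "remove_verts G X = G \<restriction> (?V - X)" for X
      by (simp add: remove_verts_def)
    show ?thesis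
      unfolding elimination_order_def shift rv Let_def inj con_circuits_induce
      using step by (simp add: image_image atLeast0LessThan Ball_def cong: conj_cong)
  qed
  have "vertex_decomposable (Sigma_complex r G)" if "?small \<or> (\<exists>k x. ?order k x)"
  proof -
    have "\<exists>k f. elimination_order r ?V k f"
    proof (cases ?small)
      case True
      then have "elimination_order r ?V 0 undefined"
        by (simp add: elimination_order_def con_circuits_verts)
      then show ?thesis by blast
    next
      case False
      with that show ?thesis unfolding order_iff by blast
    qed
    then show ?thesis
      unfolding Sigma using vertex_decomposable_if_elimination_order[OF finite_verts assms(2)] by blast
  qed
  moreover have "?small \<or> (\<exists>k x. ?order k x)" if vd: "vertex_decomposable (Sigma_complex r G)"
  proof -
    obtain k f where f: "elimination_order r ?V k f"
      using elimination_order_if_vertex_decomposable[OF _ finite_verts assms(2)] vd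
      unfolding Sigma by blast
    \<comment> \<open>The order is truncated at the first prefix leaving at most one circuit; the
      prefix conditions survive truncation, and \<open>m = 0\<close> is the first
      alternative.\<close>
    define P where "P j \<longleftrightarrow> card (circuits_in r (?V - f ` {..<j})) \<le> 1" for j
    define m where "m = (LEAST j. P j)"
    have "P k" using f by (simp add: P_def elimination_order_def)
    then have "P m" "m \<le> k" unfolding m_def by (auto intro: LeastI Least_le)
    have least: "\<not> P j" if "j < m" for j
      using that unfolding m_def by (rule not_less_Least)
    show ?thesis
    proof (cases "m = 0")
      case True
      with \<open>P m\<close> show ?thesis by (simp add: P_def con_circuits_verts)
    next
      case False
      have "elimination_order r ?V m f"
        using f \<open>P m\<close> \<open>m \<le> k\<close> unfolding elimination_order_def P_def
        by (auto intro: inj_on_subset)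
      \<comment> \<open>The index \<open>i - 1\<close> undoes the shift; the value at
        \<open>0\<close> lies outside \<open>{1..m}\<close>.\<close>
      with False least have "?order m (\<lambda>i. f (i - 1))"
        unfolding order_iff[of m "\<lambda>i. f (i - 1)"] by (simp add: image_image P_def)
      then show ?thesis by blast
    qed
  qed
  ultimately show ?thesis by blast
qed

end
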